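(* Let $\mathbf s$ be an epistandard word with directive word $\Delta=x_1x_2x_3\cdots$ ($x_i\in\mathcal A$), and let $m$ be the smallest positive integer such that $\mathrm{Alph}(x_1x_2\cdots x_m)=\mathrm{Alph}(\mathbf s)$. Then, for all $n\ge m$, $Pal(x_1\cdots x_n)$ is a quasiperiod of $\mathbf s$.
   Context: $\mathcal A$ is a finite alphabet; $\mathrm{Alph}(u)$ is the set of letters of $u$. $Pal$ is the iterated palindromic closure: $Pal(\varepsilon)=\varepsilon$, and for a word $w$ and letter $x$, $Pal(wx)$ is the shortest palindrome having $Pal(w)x$ as a prefix. An infinite word $\mathbf s$ is epistandard (standard episturmian) iff there is an infinite word $\Delta=x_1x_2\cdots$ over $\mathcal A$ with $\mathbf s=\lim_{n\to\infty}Pal(x_1\cdots x_n)$; this $\Delta$ is unique and called the directive word of $\mathbf s$. A finite word $u$ is a quasiperiod of an infinite word $\mathbf w$ if there are words $p_n$ ($n\ge0$) with $p_0=\varepsilon$, $|p_n|<|p_{n+1}|\le|p_nu|$ and $p_nu$ a prefix of $\mathbf w$ for all $n$. *)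

theory Defs
  imports "HOL-Library.Sublist" "HOL-Library.Omega_Words_Fun"
begin

text \<open>
  Infinite words are functions on the naturals, so the infinite word $x_1 x_2 x_3 \ldots$ is
  \<open>\<Delta>\<close> with $x_i = \Delta(i-1)$, and $x_1 \cdots x_n$ is \<open>\<Delta> [0 \<rightarrow> n]\<close>.
  The alphabet is the universe of the letter type.
\<close>

definition palindrome :: "'a list \<Rightarrow> bool" where
  "palindrome w \<longleftrightarrow> rev w = w"

definition pal_closure :: "'a list \<Rightarrow> 'a list" where
  "pal_closure u = (ARG_MIN length v. palindrome v \<and> Sublist.prefix u v)"

definition Pal :: "'a list \<Rightarrow> 'a list" where
  "Pal w = foldl (\<lambda>p x. pal_closure (p @ [x])) [] w"

lemma Pal_Nil [simp]: "Pal [] = []"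
  by (simp add: Pal_def)

lemma Pal_snoc [simp]: "Pal (w @ [x]) = pal_closure (Pal w @ [x])"
  by (simp add: Pal_def)

lemma pal_closure_palindrome: "palindrome (pal_closure u)" (is ?P)
  and prefix_pal_closure: "Sublist.prefix u (pal_closure u)" (is ?Q)
  and pal_closure_minimal:
    "\<lbrakk>palindrome v; Sublist.prefix u v\<rbrakk> \<Longrightarrow> length (pal_closure u) \<le> length v"
proof -
  have ex: "palindrome (u @ rev u) \<and> Sublist.prefix u (u @ rev u)"
    by (simp add: palindrome_def)
  show ?P ?Q
    using arg_min_natI [of "\<lambda>v. palindrome v \<and> Sublist.prefix u v", OF ex, of length]
    by (simp_all add: pal_closure_def)
  show "length (pal_closure u) \<le> length v" if "palindrome v" "Sublist.prefix u v"
    using arg_min_nat_le [of "\<lambda>v. palindrome v \<and> Sublist.prefix u v" v length] that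
    by (simp add: pal_closure_def)
qed

text \<open>The shortest palindrome with a given prefix is unique, so the choice made by the minimum
  operator is immaterial.\<close>

lemma pal_closure_unique:
  assumes v: "palindrome v" "Sublist.prefix u v"
    and min: "\<And>v'. \<lbrakk>palindrome v'; Sublist.prefix u v'\<rbrakk> \<Longrightarrow> length v \<le> length v'"
  shows "v = pal_closure u"
proof (rule nth_equalityI)
  let ?c = "pal_closure u"
  show len: "length v = length ?c"
    using min [OF pal_closure_palindrome prefix_pal_closure] pal_closure_minimal [OF v] by simp
  have le: "length ?c \<le> 2 * length u"
    using pal_closure_minimal [of "u @ rev u" u] by (simp add: palindrome_def)
  have pre: "w ! i = u ! i" if "Sublist.prefix u w" "i < length u" for w i
    using that by (auto simp: prefix_def nth_append)
  have mirror: "w ! i = w ! (length w - Suc i)" if "palindrome w" "i < length w" for w :: "'a list" and i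
    using that by (metis palindrome_def rev_nth)
  fix i assume i: "i < length v"
  show "v ! i = ?c ! i"
  proof (cases "i < length u")
    case True
    then show ?thesis using pre v(2) prefix_pal_closure by metis
  next
    case False
    then have "length v - Suc i < length u" using i le len by simp
    then show ?thesis
      using mirror [OF v(1) i] mirror [OF pal_closure_palindrome, of i u] i len
        pre [OF v(2)] pre [OF prefix_pal_closure] by simp
  qed
qed

definition prefix_of_word :: "'a list \<Rightarrow> 'a word \<Rightarrow> bool" where
  "prefix_of_word u w \<longleftrightarrow> u = w [0 \<rightarrow> length u]"

text \<open>Convergence of a sequence of finite words to an infinite word: every prefix of the limit is
  eventually a prefix of the members of the sequence.\<close>

definition words_converge :: "(nat \<Rightarrow> 'a list) \<Rightarrow> 'a word \<Rightarrow> bool" where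
  "words_converge u w \<longleftrightarrow> (\<forall>k. \<forall>\<^sub>F n in sequentially. Sublist.prefix (w [0 \<rightarrow> k]) (u n))"

definition directive_word :: "'a word \<Rightarrow> 'a word \<Rightarrow> bool" where
  "directive_word \<Delta> s \<longleftrightarrow> words_converge (\<lambda>n. Pal (\<Delta> [0 \<rightarrow> n])) s"

definition epistandard :: "'a word \<Rightarrow> bool" where
  "epistandard s \<longleftrightarrow> (\<exists>\<Delta>. directive_word \<Delta> s)"

definition quasiperiod :: "'a list \<Rightarrow> 'a word \<Rightarrow> bool" where
  "quasiperiod u w \<longleftrightarrow>
    (\<exists>p :: nat \<Rightarrow> 'a list. p 0 = [] \<and>
      (\<forall>n. length (p n) < length (p (Suc n)) \<and> length (p (Suc n)) \<le> length (p n @ u) \<and>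
           prefix_of_word (p n @ u) w))"

end

theory Submission
  imports Defs
begin

text \<open>
  Let $P_k = Pal(x_1 \cdots x_k)$. Each $P_k$ is both a prefix and a suffix of $P_{k+1}$. If the
  letter $x = x_{k+1}$ already occurs as $x_{j+1}$ with $j < k$, then $P_j x$ is a prefix of the
  palindrome $P_k$, so $x P_j x$ is a palindromic suffix of $P_k x$; reflecting in it gives
  $|P_{k+1}| \leq 2 |P_k|$, whence the two copies of $P_k$ cover $P_{k+1}$. For $k \geq m$ every new
  letter is an old one, so $P_n$ covers all $P_k$ with $k \geq n \geq m$, hence $\mathbf s$.
\<close>

text \<open>Stated position by position rather than as a chain of occurrences, so that it extends to
  longer words directly; \<open>quasiperiodI\<close> recovers the chain at the end.\<close>

definition covers :: "'a list \<Rightarrow> 'a list \<Rightarrow> bool" where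
  "covers u w \<longleftrightarrow>
    (\<forall>t<length w. \<exists>a b. w = a @ u @ b \<and> length a \<le> t \<and> t < length a + length u)"

lemma covers_refl: "covers u u"
  unfolding covers_def by (metis append_Nil append_Nil2 add_0 le0 list.size(3))

text \<open>The length bound makes the prefix copy and the suffix copy of \<open>v\<close> meet or
  overlap: a position outside the first copy lies in the second, where the occurrence of
  \<open>u\<close> is shifted by \<open>length y\<close>.\<close>

lemma covers_overlap:
  assumes "covers u v" "Sublist.prefix v w" "Sublist.suffix v w" "length w \<le> 2 * length v"
  shows "covers u w"
  unfolding covers_def
proof (intro allI impI)
  fix t assume t: "t < length w"
  obtain z y where z: "w = v @ z" and y: "w = y @ v"
    using assms(2,3) unfolding prefix_def Sublist.suffix_def by blast
  show "\<exists>a b. w = a @ u @ b \<and> length a \<le> t \<and> t < length a + length u"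
  proof (cases "t < length v")
    case True
    then obtain a b where "v = a @ u @ b" "length a \<le> t" "t < length a + length u"
      using assms(1) by (auto simp: covers_def)
    then show ?thesis using z by auto
  next
    case False
    have len: "length w = length y + length v" using y by simp
    then have "t - length y < length v" and le: "length y \<le> t"
      using False t assms(4) by auto
    then obtain a b where "v = a @ u @ b" "length a \<le> t - length y"
        "t - length y < length a + length u"
      using assms(1) by (auto simp: covers_def)
    then have "w = (y @ a) @ u @ b \<and> length (y @ a) \<le> t \<and> t < length (y @ a) + length u"
      using y le by auto
    then show ?thesis by blast
  qed
qed

lemma prefix_imp_suffix_palindrome:
  assumes "palindrome w" "Sublist.prefix u w"
  shows "Sublist.suffix (rev u) w"
  using assms by (simp add: palindrome_def suffix_to_prefix)

text \<open>Reflecting \<open>u\<close> in its palindromic suffix \<open>q\<close> gives the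
  competitor \<open>y @ q @ rev y\<close> in the minimum.\<close>

lemma pal_closure_length_le:
  assumes "u = y @ q" "palindrome q"
  shows "length (pal_closure u) \<le> length u + length y"
proof -
  have "palindrome (y @ q @ rev y)" "Sublist.prefix u (y @ q @ rev y)"
    using assms by (auto simp: palindrome_def)
  from pal_closure_minimal [OF this] show ?thesis using assms(1) by simp
qed

text \<open>The closure is at most twice as long as \<open>u\<close>, so the part \<open>z\<close>
  added after \<open>u\<close> mirrors a prefix of \<open>u\<close> and brings no new
  letter.\<close>

lemma set_pal_closure: "set (pal_closure u) = set u"
proof
  let ?c = "pal_closure u"
  obtain z where z: "?c = u @ z" using prefix_pal_closure [of u] by (auto simp: prefix_def)
  then show "set u \<subseteq> set ?c" by auto
  have le: "length ?c \<le> 2 * length u"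
    using pal_closure_minimal [of "u @ rev u" u] by (simp add: palindrome_def)
  have "rev z @ rev u = u @ z"
    using pal_closure_palindrome [of u] by (simp add: z palindrome_def)
  then have "rev z = take (length z) u"
    using le z by (auto simp: append_eq_append_conv_if)
  then have "set z \<subseteq> set u" by (metis set_rev set_take_subset)
  then show "set ?c \<subseteq> set u" using z by simp
qed

lemma set_Pal: "set (Pal w) = set w"
  by (induction w rule: rev_induct) (simp_all add: set_pal_closure)

lemma palindrome_Pal: "palindrome (Pal w)"
  by (cases w rule: rev_cases) (simp_all add: pal_closure_palindrome, simp add: palindrome_def)

lemma prefix_Pal_Suc: "Sublist.prefix (Pal (\<Delta> [0 \<rightarrow> n]) @ [\<Delta> n]) (Pal (\<Delta> [0 \<rightarrow> Suc n]))"
  by (simp only: subseq_to_Suc le0 Pal_snoc prefix_pal_closure)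

lemma prefix_Pal_mono: "j \<le> k \<Longrightarrow> Sublist.prefix (Pal (\<Delta> [0 \<rightarrow> j])) (Pal (\<Delta> [0 \<rightarrow> k]))"
proof (induction rule: dec_induct)
  case (step k)
  then show ?case using prefix_Pal_Suc [of \<Delta> k] by (meson append_prefixD prefix_order.trans)
qed simp

lemma length_Pal_Suc_le:
  assumes "\<Delta> k \<in> set (\<Delta> [0 \<rightarrow> k])"
  shows "length (Pal (\<Delta> [0 \<rightarrow> Suc k])) \<le> 2 * length (Pal (\<Delta> [0 \<rightarrow> k]))"
proof -
  let ?P = "\<lambda>k. Pal (\<Delta> [0 \<rightarrow> k])" and ?x = "\<Delta> k"
  obtain j where j: "j < k" "\<Delta> j = ?x" using assms by (auto simp: subsequence_def)
  \<comment> \<open>As \<open>j < k\<close>, already \<open>?P (Suc j)\<close> is a prefix of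
    \<open>?P k\<close>.\<close>
  have "Sublist.prefix (?P j @ [?x]) (?P k)"
    using prefix_Pal_Suc [of \<Delta> j] prefix_Pal_mono [of "Suc j" k \<Delta>] j
    by (metis Suc_leI prefix_order.trans)
  then have "Sublist.suffix (rev (?P j @ [?x])) (?P k)"
    by (rule prefix_imp_suffix_palindrome [OF palindrome_Pal])
  moreover have "rev (?P j) = ?P j" using palindrome_Pal by (simp add: palindrome_def)
  ultimately obtain y where y: "?P k = y @ [?x] @ ?P j" by (auto simp: Sublist.suffix_def)
  have "palindrome ([?x] @ ?P j @ [?x])"
    using \<open>rev (?P j) = ?P j\<close> by (simp add: palindrome_def)
  with y have "length (pal_closure (?P k @ [?x])) \<le> length (?P k @ [?x]) + length y"
    by (intro pal_closure_length_le) auto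
  \<comment> \<open>Since \<open>length (?P k) = length y + 1 + length (?P j)\<close>, the bound
    equals \<open>2 * length (?P k) - length (?P j)\<close>.\<close>
  also have "\<dots> \<le> 2 * length (?P k)" by (simp add: y)
  finally show ?thesis by (simp only: subseq_to_Suc le0 Pal_snoc)
qed

lemma covers_Pal:
  assumes "n \<le> k" and old: "\<And>i. n \<le> i \<Longrightarrow> \<Delta> i \<in> set (\<Delta> [0 \<rightarrow> i])"
  shows "covers (Pal (\<Delta> [0 \<rightarrow> n])) (Pal (\<Delta> [0 \<rightarrow> k]))"
  using assms(1)
proof (induction rule: dec_induct)
  case base
  show ?case by (rule covers_refl)
next
  case (step k)
  have pre: "Sublist.prefix (Pal (\<Delta> [0 \<rightarrow> k])) (Pal (\<Delta> [0 \<rightarrow> Suc k]))"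
    by (rule prefix_Pal_mono) simp
  have "Sublist.suffix (Pal (\<Delta> [0 \<rightarrow> k])) (Pal (\<Delta> [0 \<rightarrow> Suc k]))"
    using prefix_imp_suffix_palindrome [OF palindrome_Pal pre] palindrome_Pal [of "\<Delta> [0 \<rightarrow> k]"]
    by (simp only: palindrome_def)
  with step pre show ?case using covers_overlap length_Pal_Suc_le old by blast
qed

text \<open>Convergence only makes prefixes of \<open>s\<close> prefixes of late members of the
  sequence. As these members form a prefix chain, \<open>?P k\<close> and the prefix of
  \<open>s\<close> of the same length are both prefixes of one late member, hence equal.\<close>

lemma prefix_of_word_Pal:
  assumes "directive_word \<Delta> s"
  shows "prefix_of_word (Pal (\<Delta> [0 \<rightarrow> k])) s"
proof -
  let ?P = "\<lambda>k. Pal (\<Delta> [0 \<rightarrow> k])"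
  have "\<forall>\<^sub>F n in sequentially. Sublist.prefix (s [0 \<rightarrow> length (?P k)]) (?P n)"
    using assms by (simp add: directive_word_def words_converge_def)
  then obtain N where "\<And>n. N \<le> n \<Longrightarrow> Sublist.prefix (s [0 \<rightarrow> length (?P k)]) (?P n)"
    by (auto simp: eventually_sequentially)
  then have "Sublist.prefix (s [0 \<rightarrow> length (?P k)]) (?P (max N k))" by simp
  moreover have "Sublist.prefix (?P k) (?P (max N k))" by (simp add: prefix_Pal_mono)
  ultimately have "s [0 \<rightarrow> length (?P k)] = ?P k"
    using prefix_length_prefix [of "s [0 \<rightarrow> length (?P k)]" "?P (max N k)" "?P k"]
      prefix_length_prefix [of "?P k" "?P (max N k)" "s [0 \<rightarrow> length (?P k)]"]
    by (simp add: prefix_order.antisym)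
  then show ?thesis by (simp add: prefix_of_word_def)
qed

lemma prefix_of_word_appendD: "prefix_of_word (u @ v) w \<Longrightarrow> prefix_of_word u w"
  by (simp add: prefix_of_word_def subsequence_append)

lemma prefix_of_word_set: "prefix_of_word u w \<Longrightarrow> set u \<subseteq> range w"
  unfolding prefix_of_word_def by (metis image_mono set_subsequence top_greatest)

text \<open>Convergence forces late members to contain the prefix of \<open>s\<close> of length
  \<open>Suc t\<close>, so every position of \<open>s\<close> falls inside some \<open>Pal\<close>
  prefix, with \<open>k\<close> as large as desired.\<close>

lemma long_prefix_of_directed_word:
  assumes "directive_word \<Delta> s"
  obtains k where "n \<le> k" "t < length (Pal (\<Delta> [0 \<rightarrow> k]))"
proof -
  have "\<forall>\<^sub>F k in sequentially. Sublist.prefix (s [0 \<rightarrow> Suc t]) (Pal (\<Delta> [0 \<rightarrow> k]))"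
    using assms unfolding directive_word_def words_converge_def by blast
  then obtain N where "\<And>k. N \<le> k \<Longrightarrow> Sublist.prefix (s [0 \<rightarrow> Suc t]) (Pal (\<Delta> [0 \<rightarrow> k]))"
    by (auto simp: eventually_sequentially)
  then have "Sublist.prefix (s [0 \<rightarrow> Suc t]) (Pal (\<Delta> [0 \<rightarrow> max N n]))" by simp
  then have "t < length (Pal (\<Delta> [0 \<rightarrow> max N n]))"
    by (auto dest!: prefix_length_le)
  then show ?thesis using that [of "max N n"] by simp
qed

lemma range_directed_word_subset:
  assumes "directive_word \<Delta> s"
  shows "range s \<subseteq> range \<Delta>"
proof
  fix c assume "c \<in> range s"
  then obtain t where t: "c = s t" by blast
  obtain k where k: "t < length (Pal (\<Delta> [0 \<rightarrow> k]))"
    using long_prefix_of_directed_word [OF assms] by blast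
  let ?u = "Pal (\<Delta> [0 \<rightarrow> k])"
  have "?u = s [0 \<rightarrow> length ?u]"
    using prefix_of_word_Pal [OF assms] unfolding prefix_of_word_def .
  then have "?u ! t = s [0 \<rightarrow> length ?u] ! t" by (rule arg_cong)
  also have "\<dots> = s t" using k by simp
  finally have "c \<in> set (\<Delta> [0 \<rightarrow> k])" using t k by (metis nth_mem set_Pal)
  then show "c \<in> range \<Delta>" by (auto simp: subsequence_def)
qed

lemma directive_letters_subset:
  assumes "directive_word \<Delta> s"
  shows "range \<Delta> \<subseteq> range s"
proof
  fix c assume "c \<in> range \<Delta>"
  then obtain k where "c = \<Delta> k" by blast
  then have "c \<in> set (Pal (\<Delta> [0 \<rightarrow> Suc k]))" by (simp only: set_Pal subseq_to_Suc le0) simp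
  then show "c \<in> range s" using prefix_of_word_set [OF prefix_of_word_Pal [OF assms]] by blast
qed

text \<open>Finiteness of the alphabet enters here: finitely many positions \<open>C\<close> exhibit
  all letters. This ensures that the least number defining \<open>m\<close> exists.\<close>

lemma ex_prefix_all_letters:
  fixes w :: "'a::finite word"
  shows "\<exists>k>0. set (w [0 \<rightarrow> k]) = range w"
proof -
  obtain C where C: "finite C" "range w = w ` C"
    using finite_subset_image [of "range w" w UNIV] by auto
  then obtain k where "\<And>c. c \<in> C \<Longrightarrow> c < k" by (meson finite_nat_set_iff_bounded)
  then have "range w \<subseteq> set (w [0 \<rightarrow> Suc k])"
    unfolding C(2) set_subsequence by (intro image_mono) force
  then have "set (w [0 \<rightarrow> Suc k]) = range w" by (auto simp: subsequence_def)
  then show ?thesis by blast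
qed

text \<open>From each occurrence of \<open>u\<close> the chain moves to one covering the first
  position behind it; that occurrence starts strictly later and leaves no gap.\<close>

lemma quasiperiodI:
  assumes cov: "\<And>t. \<exists>a. prefix_of_word (a @ u) w \<and> length a \<le> t \<and> t < length a + length u"
  shows "quasiperiod u w"
proof -
  let ?Q = "\<lambda>a. prefix_of_word (a @ u) w"
  \<comment> \<open>An occurrence covering position 0 must start there.\<close>
  have init: "?Q []" using cov [of 0] by auto
  \<comment> \<open>\<open>b\<close> marks an occurrence of \<open>u\<close> covering the first position after \<open>a @ u\<close>\<close>
  have step: "\<exists>b. ?Q b \<and> length a < length b \<and> length b \<le> length (a @ u)" for a
    using cov [of "length a + length u"] by auto
  \<comment> \<open>The clause on \<open>n = 0\<close> carries the required start
    \<open>p 0 = []\<close> through the dependent choice.\<close>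
  obtain p where p: "\<And>n. ?Q (p n) \<and> (n = 0 \<longrightarrow> p n = [])"
      "\<And>n. length (p n) < length (p (Suc n)) \<and> length (p (Suc n)) \<le> length (p n @ u)"
  proof (rule dependent_nat_choice [of "\<lambda>n a. ?Q a \<and> (n = 0 \<longrightarrow> a = [])"
        "\<lambda>n a b. length a < length b \<and> length b \<le> length (a @ u)", THEN exE])
    show "\<exists>a. ?Q a \<and> (0 = (0::nat) \<longrightarrow> a = [])" using init by blast
    show "\<exists>b. (?Q b \<and> (Suc n = 0 \<longrightarrow> b = [])) \<and> length a < length b \<and> length b \<le> length (a @ u)"
      for a n using step [of a] by blast
  qed blast
  then have "p 0 = []" by blast
  with p show ?thesis unfolding quasiperiod_def by blast
qed

theorem theorem4p10:
  fixes s \<Delta> :: "'a::finite word" and m :: nat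
  assumes "epistandard s"
    and "directive_word \<Delta> s"
    and "m = (LEAST k. 0 < k \<and> set (\<Delta> [0 \<rightarrow> k]) = range s)"
  shows "\<forall>n\<ge>m. quasiperiod (Pal (\<Delta> [0 \<rightarrow> n])) s"
proof (intro allI impI)
  fix n assume n: "m \<le> n"
  \<comment> \<open>\<open>m\<close> is defined through the letters of \<open>s\<close>, whereas the
    length bound asks for repeated letters of \<Delta>.\<close>
  have letters: "range \<Delta> = range s"
    using range_directed_word_subset directive_letters_subset assms(2) by blast
  have "set (\<Delta> [0 \<rightarrow> m]) = range s"
    using LeastI_ex [OF ex_prefix_all_letters [of \<Delta>]] assms(3) letters by simp
  then have old: "\<Delta> i \<in> set (\<Delta> [0 \<rightarrow> i])" if "n \<le> i" for i
  proof -
    \<comment> \<open>The first \<open>m\<close> letters of \<Delta> exhaust its alphabet, and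
      \<open>m \<le> n \<le> i\<close>.\<close>
    have "\<Delta> i \<in> set (\<Delta> [0 \<rightarrow> m])" using \<open>set (\<Delta> [0 \<rightarrow> m]) = range s\<close> letters by auto
    then show ?thesis using that n by (auto simp: subsequence_def)
  qed
  show "quasiperiod (Pal (\<Delta> [0 \<rightarrow> n])) s"
  proof (rule quasiperiodI)
    fix t
    obtain k where k: "n \<le> k" "t < length (Pal (\<Delta> [0 \<rightarrow> k]))"
      using long_prefix_of_directed_word [OF assms(2)] by blast
    \<comment> \<open>The occurrence covering \<open>t\<close> inside a long \<open>Pal\<close>
      prefix is an occurrence in \<open>s\<close> once the rest \<open>b\<close> is dropped.\<close>
    then obtain a b where "Pal (\<Delta> [0 \<rightarrow> k]) = (a @ Pal (\<Delta> [0 \<rightarrow> n])) @ b"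
        and "length a \<le> t" "t < length a + length (Pal (\<Delta> [0 \<rightarrow> n]))"
      using covers_Pal [OF k(1) old] by (auto simp: covers_def)
    then show "\<exists>a. prefix_of_word (a @ Pal (\<Delta> [0 \<rightarrow> n])) s \<and> length a \<le> t \<and>
        t < length a + length (Pal (\<Delta> [0 \<rightarrow> n]))"
      using prefix_of_word_Pal [OF assms(2), of k] by (metis prefix_of_word_appendD)
  qed
qed

end
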